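(* Let $(V,b,\psi)$ be a real cosymplectic vector space. There is a canonical continuous surjective map $\mathcal{F}: Riem(V)\to\tilde{\mathcal{J}}(V,b,\psi)$.
   Context: A cosymplectic vector space $(V,b,\psi)$ is a finite-dimensional real vector space $V$ with an antisymmetric bilinear form $b$ and a nonzero linear form $\psi$ such that $\widetilde I_{\psi,b}:V\to V^*$, $\widetilde I_{\psi,b}(v)(u)=b(v,u)+\psi(v)\psi(u)$, is bijective. The Reeb vector $\xi$ satisfies $\psi(\xi)=1$, $b(\xi,\cdot)=0$, and $V=\ker\psi\oplus\langle\xi\rangle$; let $p_1:V\to\ker\psi$, $p_2:V\to\langle\xi\rangle$ be the projections and $i_0:\ker\psi\to V$, $j_0:\langle\xi\rangle\to V$ the inclusions. A co-complex structure is a (linear) map $\tilde J:V\to V$ with $p_1\circ\tilde J\circ\tilde J\circ i_0=-\mathrm{Id}_{|\ker\psi}$ and $p_2\circ\tilde J\circ\tilde J\circ j_0=\mathrm{Id}_{|\langle\xi\rangle}$. It is compatible with $(b,\psi)$ if the bilinear form $\tilde g(u,v):=\widetilde I_{\psi,b}(u)(\tilde J(v))$ is a positive definite inner product on $V$. $\tilde{\mathcal{J}}(V,b,\psi)$ is the space of all compatible co-complex structures on $(V,b,\psi)$. $Riem(V)$ is the convex open subset, in the space of symmetric bilinear forms on $V$, of positive definite inner products. Both spaces carry their natural topologies as subsets of finite-dimensional vector spaces. *)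

theory Defs
  imports "HOL-Analysis.Analysis"
begin

text \<open>
  The finite-dimensional real vector space \<open>V\<close> is a type of class \<open>euclidean_space\<close>. Its built-in
  inner product is used only through the topology it induces, which does not depend on the choice.
  Since \<open>V\<close> is finite-dimensional, all linear maps out of it are bounded, so \<open>'a \<Rightarrow>\<^sub>L real\<close> is
  the full dual \<open>V*\<close>, \<open>'a \<Rightarrow>\<^sub>L 'a\<close> is \<open>End V\<close>, \<open>'a \<Rightarrow>\<^sub>L 'a \<Rightarrow>\<^sub>L real\<close> is the space of
  bilinear forms on \<open>V\<close>, and the norm topologies on these types are the natural ones.
\<close>

definition flat :: "('a::euclidean_space \<Rightarrow>\<^sub>L 'a \<Rightarrow>\<^sub>L real) \<Rightarrow> ('a \<Rightarrow>\<^sub>L real) \<Rightarrow> 'a \<Rightarrow> ('a \<Rightarrow>\<^sub>L real)"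
  where "flat b \<psi> v = b v + \<psi> v *\<^sub>R \<psi>"

lemma flat_apply: "flat b \<psi> v u = b v u + \<psi> v * \<psi> u"
  by (simp add: flat_def blinfun.add_left blinfun.scaleR_left)

text \<open>
  The last clause says that a Reeb vector exists. It is automatic for odd-dimensional \<open>V\<close>, but
  bijectivity of \<open>flat b \<psi>\<close> alone does not imply it: if \<open>b\<close> is nondegenerate (so \<open>V\<close> is
  even-dimensional), then \<open>flat b \<psi>\<close> is bijective for every \<open>\<psi>\<close>, and there is no Reeb vector.
  Given the other clauses it is equivalent to \<open>V\<close> being odd-dimensional.
\<close>

definition cosymplectic :: "('a::euclidean_space \<Rightarrow>\<^sub>L 'a \<Rightarrow>\<^sub>L real) \<Rightarrow> ('a \<Rightarrow>\<^sub>L real) \<Rightarrow> bool"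
  where "cosymplectic b \<psi> \<longleftrightarrow>
    (\<forall>u v. b u v = - b v u) \<and> \<psi> \<noteq> 0 \<and> bij (flat b \<psi>) \<and> (\<exists>\<xi>. \<psi> \<xi> = 1 \<and> b \<xi> = 0)"

definition reeb :: "('a::euclidean_space \<Rightarrow>\<^sub>L 'a \<Rightarrow>\<^sub>L real) \<Rightarrow> ('a \<Rightarrow>\<^sub>L real) \<Rightarrow> 'a"
  where "reeb b \<psi> = (THE \<xi>. \<psi> \<xi> = 1 \<and> b \<xi> = 0)"

lemma reeb_ex1:
  fixes b :: "'a::euclidean_space \<Rightarrow>\<^sub>L 'a \<Rightarrow>\<^sub>L real"
  assumes "cosymplectic b \<psi>"
  shows "\<exists>!\<xi>. \<psi> \<xi> = 1 \<and> b \<xi> = 0"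
proof -
  from assms obtain \<xi> where \<xi>: "\<psi> \<xi> = 1 \<and> b \<xi> = 0"
    by (auto simp: cosymplectic_def)
  have "inj (flat b \<psi>)"
    using assms by (simp add: cosymplectic_def bij_is_inj)
  then have "\<eta> = \<xi>" if "\<psi> \<eta> = 1 \<and> b \<eta> = 0" for \<eta>
    using that \<xi> by (auto simp: flat_def intro: injD)
  with \<xi> show ?thesis by blast
qed

lemma reeb_props:
  assumes "cosymplectic b \<psi>"
  shows "\<psi> (reeb b \<psi>) = 1" "b (reeb b \<psi>) = 0"
  using theI'[OF reeb_ex1[OF assms]] by (auto simp: reeb_def)

definition ker :: "('a::euclidean_space \<Rightarrow>\<^sub>L real) \<Rightarrow> 'a set"
  where "ker \<psi> = {v. \<psi> v = 0}"

text \<open>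
  The projections of \<open>V = ker \<psi> \<oplus> \<langle>\<xi>\<rangle>\<close> onto its summands, as maps into \<open>V\<close>; the lemma
  \<open>proj_unique\<close> below confirms that they are these projections.
\<close>

definition proj2 :: "('a::euclidean_space \<Rightarrow>\<^sub>L 'a \<Rightarrow>\<^sub>L real) \<Rightarrow> ('a \<Rightarrow>\<^sub>L real) \<Rightarrow> 'a \<Rightarrow> 'a"
  where "proj2 b \<psi> v = \<psi> v *\<^sub>R reeb b \<psi>"

definition proj1 :: "('a::euclidean_space \<Rightarrow>\<^sub>L 'a \<Rightarrow>\<^sub>L real) \<Rightarrow> ('a \<Rightarrow>\<^sub>L real) \<Rightarrow> 'a \<Rightarrow> 'a"
  where "proj1 b \<psi> v = v - \<psi> v *\<^sub>R reeb b \<psi>"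

lemma proj_unique:
  assumes "cosymplectic b \<psi>"
  shows "k \<in> ker \<psi> \<and> l \<in> span {reeb b \<psi>} \<and> v = k + l \<longleftrightarrow> k = proj1 b \<psi> v \<and> l = proj2 b \<psi> v"
  using reeb_props[OF assms]
  by (auto simp: ker_def proj1_def proj2_def span_singleton
      blinfun.add_right blinfun.diff_right blinfun.scaleR_right)

definition cocomplex ::
    "('a::euclidean_space \<Rightarrow>\<^sub>L 'a \<Rightarrow>\<^sub>L real) \<Rightarrow> ('a \<Rightarrow>\<^sub>L real) \<Rightarrow> ('a \<Rightarrow>\<^sub>L 'a) \<Rightarrow> bool"
  where "cocomplex b \<psi> J \<longleftrightarrow>
    (\<forall>v \<in> ker \<psi>. proj1 b \<psi> (J (J v)) = - v) \<and>
    (\<forall>v \<in> span {reeb b \<psi>}. proj2 b \<psi> (J (J v)) = v)"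

definition inner_product :: "('a::euclidean_space \<Rightarrow> 'a \<Rightarrow> real) \<Rightarrow> bool"
  where "inner_product g \<longleftrightarrow>
    bilinear g \<and> (\<forall>u v. g u v = g v u) \<and> (\<forall>v. v \<noteq> 0 \<longrightarrow> g v v > 0)"

definition Riem :: "('a::euclidean_space \<Rightarrow>\<^sub>L 'a \<Rightarrow>\<^sub>L real) set"
  where "Riem = {g. inner_product (\<lambda>u. blinfun_apply (blinfun_apply g u))}"

definition compatible ::
    "('a::euclidean_space \<Rightarrow>\<^sub>L 'a \<Rightarrow>\<^sub>L real) \<Rightarrow> ('a \<Rightarrow>\<^sub>L real) \<Rightarrow> ('a \<Rightarrow>\<^sub>L 'a) \<Rightarrow> bool"
  where "compatible b \<psi> J \<longleftrightarrow> inner_product (\<lambda>u v. flat b \<psi> u (J v))"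

definition compatible_cocomplex ::
    "('a::euclidean_space \<Rightarrow>\<^sub>L 'a \<Rightarrow>\<^sub>L real) \<Rightarrow> ('a \<Rightarrow>\<^sub>L real) \<Rightarrow> ('a \<Rightarrow>\<^sub>L 'a) set"
  where "compatible_cocomplex b \<psi> = {J. cocomplex b \<psi> J \<and> compatible b \<psi> J}"

definition cosymplectic_iso ::
    "('a::euclidean_space \<Rightarrow>\<^sub>L 'a \<Rightarrow>\<^sub>L real) \<Rightarrow> ('a \<Rightarrow>\<^sub>L real) \<Rightarrow>
     ('a \<Rightarrow>\<^sub>L 'a \<Rightarrow>\<^sub>L real) \<Rightarrow> ('a \<Rightarrow>\<^sub>L real) \<Rightarrow> ('a \<Rightarrow>\<^sub>L 'a) \<Rightarrow> bool"
  where "cosymplectic_iso b \<psi> b' \<psi>' \<phi> \<longleftrightarrow>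
    bij (blinfun_apply \<phi>) \<and> (\<forall>u v. b' (\<phi> u) (\<phi> v) = b u v) \<and> (\<forall>v. \<psi>' (\<phi> v) = \<psi> v)"

text \<open>
  Canonicity of a construction \<open>F\<close>, sending a cosymplectic structure \<open>(b, \<psi>)\<close> and an inner
  product \<open>g\<close> to an endomorphism, means naturality: an isomorphism \<open>\<phi>\<close> carrying \<open>(b, \<psi>, g)\<close> to
  \<open>(b', \<psi>', g')\<close> conjugates \<open>F b \<psi> g\<close> to \<open>F b' \<psi>' g'\<close>, so \<open>F\<close> involves no choices. As spaces
  of equal dimension are isomorphic, one type suffices for all spaces of its dimension; the case
  \<open>(b, \<psi>) = (b', \<psi>')\<close> is equivariance under the automorphism group.
\<close>

definition canonical ::
    "(('a::euclidean_space \<Rightarrow>\<^sub>L 'a \<Rightarrow>\<^sub>L real) \<Rightarrow> ('a \<Rightarrow>\<^sub>L real) \<Rightarrow>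
      ('a \<Rightarrow>\<^sub>L 'a \<Rightarrow>\<^sub>L real) \<Rightarrow> ('a \<Rightarrow>\<^sub>L 'a)) \<Rightarrow> bool"
  where "canonical F \<longleftrightarrow>
    (\<forall>b \<psi> b' \<psi>' \<phi> g g'.
      cosymplectic b \<psi> \<longrightarrow> cosymplectic b' \<psi>' \<longrightarrow> cosymplectic_iso b \<psi> b' \<psi>' \<phi> \<longrightarrow>
      g \<in> Riem \<longrightarrow> g' \<in> Riem \<longrightarrow> (\<forall>u v. g' (\<phi> u) (\<phi> v) = g u v) \<longrightarrow>
      (\<forall>v. F b' \<psi>' g' (\<phi> v) = \<phi> (F b \<psi> g v)))"

end

theory Submission
  imports Defs
begin

text \<open>
  Restrict \<open>g\<close> to \<open>ker \<psi>\<close> and extend it to an inner product \<open>g'\<close> on \<open>V = ker \<psi> \<oplus> \<langle>\<xi>\<rangle>\<close> for which the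
  splitting is orthogonal and \<open>\<xi>\<close> is a unit vector. Let \<open>F b \<psi> g\<close> be the orthogonal factor in the polar decomposition of
  \<open>flat b \<psi>\<close> with respect to \<open>g'\<close>: the unique \<open>g'\<close>-isometry \<open>J\<close> for which \<open>flat b \<psi> u (J v)\<close> is an
  inner product. Uniqueness yields naturality, continuity (as the defining conditions
  are closed and \<open>g'\<close>-isometries are locally bounded) and the identity \<open>J \<circ> J = - id\<close> on \<open>ker \<psi>\<close>,
  \<open>J \<circ> J = id\<close> on \<open>\<langle>\<xi>\<rangle>\<close>: if \<open>S\<close> is the involution with these values, then the transpose of
  \<open>flat b \<psi>\<close> is \<open>flat b \<psi> \<circ> S\<close>, so \<open>S \<circ> inv J\<close> satisfies the conditions that determine \<open>J\<close>.
  Conversely a compatible \<open>J\<close> fixes \<open>\<xi>\<close> and preserves \<open>ker \<psi>\<close>, and then it is an isometry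
  of the inner product \<open>flat b \<psi> u (J v)\<close>, so it is the value of \<open>F b \<psi>\<close> at that inner product.
\<close>

section \<open>Inner products\<close>

lemmas bilinear_simps = bilinear_ladd bilinear_radd bilinear_lmul bilinear_rmul
  bilinear_lsub bilinear_rsub bilinear_lneg bilinear_rneg bilinear_lzero bilinear_rzero

lemma inner_productD:
  assumes "inner_product g"
  shows "bilinear g" "g u v = g v u" "v \<noteq> 0 \<Longrightarrow> g v v > 0" "g v v \<ge> 0" "g v v = 0 \<longleftrightarrow> v = 0"
proof -
  show bil: "bilinear g" and "g u v = g v u" and pos: "v \<noteq> 0 \<Longrightarrow> g v v > 0" for u v
    using assms by (auto simp: inner_product_def)
  have zero: "g 0 0 = 0"
    using bil by (simp add: bilinear_lzero)
  show "g v v \<ge> 0" "g v v = 0 \<longleftrightarrow> v = 0"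
    using pos[of v] zero by (cases "v = 0"; simp)+
qed

text \<open>A derivative-free first-order condition: near \<open>0\<close> a nonzero linear term
  beats a quadratic one for \<open>t\<close> of a suitable sign. It drives the variational arguments
  below.\<close>

lemma linear_coeff_eq_0_if_dominated:
  fixes a c :: real
  assumes "\<And>t. t * a \<le> t\<^sup>2 * c"
  shows "a = 0"
proof (rule ccontr)
  assume "a \<noteq> 0"
  \<comment> \<open>At \<open>t = a / d\<close> the left side equals \<open>t * t * d\<close>, so
    any positive \<open>d\<close> above \<open>c\<close> gives a contradiction.\<close>
  define d where "d = \<bar>c\<bar> + 1"
  have "d > 0" "c < d" by (auto simp: d_def)
  have "(a / d) * a \<le> (a / d)\<^sup>2 * c" by (rule assms)
  also have "\<dots> < (a / d)\<^sup>2 * d"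
    using \<open>a \<noteq> 0\<close> \<open>d > 0\<close> \<open>c < d\<close> by (intro mult_strict_left_mono) auto
  also have "\<dots> = (a / d) * a"
    using \<open>d > 0\<close> by (simp add: power2_eq_square)
  finally show False by simp
qed

text \<open>Along \<open>v + t *\<^sub>R u\<close> the nonnegative quadratic form has no constant
  term, so its linear coefficient \<open>2 * q u v\<close> must vanish.\<close>

lemma semidefinite_null_vector:
  fixes q :: "'a::euclidean_space \<Rightarrow> 'a \<Rightarrow> real"
  assumes bil: "bilinear q" and sym: "\<And>u v. q u v = q v u" and nonneg: "\<And>v. q v v \<ge> 0"
    and null: "q v v = 0"
  shows "q u v = 0"
proof -
  have "t * (- 2 * q u v) \<le> t\<^sup>2 * q u u" for t
  proof -
    have "0 \<le> q (v + t *\<^sub>R u) (v + t *\<^sub>R u)" by (rule nonneg)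
    also have "\<dots> = t * (2 * q u v) + t\<^sup>2 * q u u"
      using bil null sym[of v u] by (simp add: bilinear_simps power2_eq_square algebra_simps)
    finally show ?thesis by simp
  qed
  from linear_coeff_eq_0_if_dominated[OF this] show ?thesis by simp
qed

lemma bilinear_continuous_on_diag:
  fixes h :: "'a::euclidean_space \<Rightarrow> 'a \<Rightarrow> real"
  assumes "bilinear h"
  shows "continuous_on S (\<lambda>v. h v v)"
  using bilinear_continuous_on_compose[OF continuous_on_id continuous_on_id assms] by simp

lemma bilinear_homogeneous:
  assumes "bilinear h"
  shows "h (c *\<^sub>R v) (c *\<^sub>R v) = c\<^sup>2 * (h v v :: real)"
  using assms by (simp add: bilinear_simps power2_eq_square)

text \<open>The ratio \<open>h u u / k u u\<close> attains its maximum on the compact unit sphere,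
  and homogeneity extends the bound to all vectors. For symmetric \<open>h\<close> this yields the
  largest eigenvalue of \<open>h\<close> relative to \<open>k\<close>, with an eigenvector.\<close>

lemma bilinear_max_ratio:
  fixes h k :: "'a::euclidean_space \<Rightarrow> 'a \<Rightarrow> real"
  assumes h: "bilinear h" and k: "inner_product k"
  obtains l v where "v \<noteq> 0" "h v v = l * k v v" "\<And>u. h u u \<le> l * k u u"
proof -
  note k' = inner_productD[OF k]
  have nz: "k v v \<noteq> 0" if "v \<in> sphere 0 1" for v
    using k'(5)[of v] that by auto
  have nonempty: "sphere (0::'a) 1 \<noteq> {}"
    using sphere_empty by fastforce
  have cont: "continuous_on (sphere 0 1) (\<lambda>v. h v v / k v v)"
    using nz by (intro continuous_on_divide bilinear_continuous_on_diag h k'(1)) auto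
  obtain v where v: "v \<in> sphere 0 1"
    and max: "\<And>u. u \<in> sphere 0 1 \<Longrightarrow> h u u / k u u \<le> h v v / k v v"
    using continuous_attains_sup[OF compact_sphere nonempty cont] by blast
  define l where "l = h v v / k v v"
  show ?thesis
  proof
    show "v \<noteq> 0" using v by auto
    show "h v v = l * k v v" using nz[OF v] by (simp add: l_def)
    show "h u u \<le> l * k u u" for u
    proof (cases "u = 0")
      case True
      then show ?thesis using h k'(1) by (simp add: bilinear_lzero)
    next
      case False
      define w where "w = (1 / norm u) *\<^sub>R u"
      have u: "u = norm u *\<^sub>R w" and w: "w \<in> sphere 0 1"
        using False by (auto simp: w_def)
      then have "k w w > 0" by (intro k'(3)) auto
      with max[OF w] have "h w w \<le> l * k w w"
        by (simp add: l_def[symmetric] divide_simps)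
      then have "(norm u)\<^sup>2 * h w w \<le> (norm u)\<^sup>2 * (l * k w w)"
        by (intro mult_left_mono) auto
      then show ?thesis
        by (subst (1 2 3 4) u) (simp add: bilinear_homogeneous[OF h] bilinear_homogeneous[OF k'(1)]
            mult.left_commute)
    qed
  qed
qed

lemma inner_product_inner: "inner_product (\<bullet>)"
  by (simp add: inner_product_def inner_commute bilinear_conv_bounded_bilinear bounded_bilinear_inner)

text \<open>Both constants come from \<open>bilinear_max_ratio\<close>, applied to \<open>g\<close>
  against the Euclidean product and the other way round.\<close>

lemma inner_product_bounds:
  fixes g :: "'a::euclidean_space \<Rightarrow> 'a \<Rightarrow> real"
  assumes "inner_product g"
  obtains c D where "c > 0" "D > 0" "\<And>v. c * (norm v)\<^sup>2 \<le> g v v" "\<And>v. g v v \<le> D * (norm v)\<^sup>2"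
proof -
  note g = inner_productD[OF assms]
  obtain l1 v1 where 1: "v1 \<noteq> 0" "g v1 v1 = l1 * (v1 \<bullet> v1)" "\<And>u. g u u \<le> l1 * (u \<bullet> u)"
    by (rule bilinear_max_ratio[OF g(1) inner_product_inner]) (rule that)
  obtain l2 v2 where 2: "v2 \<noteq> 0" "v2 \<bullet> v2 = l2 * g v2 v2" "\<And>u. u \<bullet> u \<le> l2 * g u u"
    by (rule bilinear_max_ratio[OF inner_productD(1)[OF inner_product_inner] assms]) (rule that)
  have "l1 > 0"
    using 1(1,2) g(3)[of v1] by (metis inner_gt_zero_iff zero_less_mult_pos2)
  have "l2 > 0"
    using 2(1,2) g(3)[of v2] by (metis inner_gt_zero_iff zero_less_mult_pos2)
  show ?thesis
  proof
    show "1 / l2 > 0" "l1 > 0" using \<open>l1 > 0\<close> \<open>l2 > 0\<close> by auto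
    show "1 / l2 * (norm v)\<^sup>2 \<le> g v v" "g v v \<le> l1 * (norm v)\<^sup>2" for v
      using 1(3)[of v] 2(3)[of v] \<open>l2 > 0\<close>
      by (auto simp: power2_norm_eq_inner divide_simps mult.commute)
  qed
qed

lemma inner_product_representation:
  fixes g B :: "'a::euclidean_space \<Rightarrow> 'a \<Rightarrow> real"
  assumes g: "inner_product g" and B: "bilinear B"
  obtains C where "linear C" "\<And>u v. g u (C v) = B u v"
proof -
  note g' = inner_productD[OF g]
  \<comment> \<open>\<open>rep h\<close> is the matrix of the form \<open>h\<close> for the
    Euclidean product; the map sought is \<open>rep B\<close> followed by the inverse of
    \<open>rep g\<close>.\<close>
  define rep where "rep h v = (\<Sum>i\<in>Basis. h i v *\<^sub>R i)" for h :: "'a \<Rightarrow> 'a \<Rightarrow> real" and v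
  have lin: "linear (rep h)" if "bilinear h" for h
    using that by (intro linearI) (simp_all add: rep_def bilinear_simps scaleR_add_left sum.distrib
        scaleR_sum_right)
  have rep: "u \<bullet> rep h v = h u v" if "bilinear h" for h u v
  proof -
    have "linear (\<lambda>u. h u v)" using that by (simp add: bilinear_def)
    then have "h (\<Sum>i\<in>Basis. (u \<bullet> i) *\<^sub>R i) v = (\<Sum>i\<in>Basis. (u \<bullet> i) *\<^sub>R h i v)"
      by (subst linear_sum[of "\<lambda>u. h u v"]) (auto simp: bilinear_lmul[OF that])
    then show ?thesis
      by (simp add: euclidean_representation rep_def inner_sum_right mult.commute)
  qed
  have "rep g v = 0 \<Longrightarrow> v = 0" for v
    using rep[OF g'(1), of v v] g'(5)[of v] by simp
  then have inj: "inj (rep g)"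
    using lin[OF g'(1)] by (simp add: linear_injective_0)
  then have surj: "surj (rep g)"
    using lin[OF g'(1)] linear_injective_imp_surjective by blast
  obtain G where G: "linear G" "rep g \<circ> G = id"
    using linear_surjective_right_inverse[OF lin[OF g'(1)] surj] by blast
  show ?thesis
  proof
    show "linear (G \<circ> rep B)" using G(1) lin[OF B] by (rule linear_compose[rotated])
    have "rep g (G x) = x" for x using G(2) by (simp add: fun_eq_iff)
    then show "g u ((G \<circ> rep B) v) = B u v" for u v
      using rep[OF g'(1), of u "G (rep B v)"] rep[OF B, of u v] by simp
  qed
qed

section \<open>The orthogonal polar factor\<close>

text \<open>With \<open>B u v = g u (C v)\<close>, the second condition makes
  \<open>C \<circ> J\<close> self-adjoint and positive for \<open>g\<close>, so \<open>J\<close> is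
  the inverse of the orthogonal factor of \<open>C\<close>. This form avoids adjoints and square
  roots.\<close>

definition polar :: "('a::euclidean_space \<Rightarrow> 'a \<Rightarrow> real) \<Rightarrow> ('a \<Rightarrow> 'a \<Rightarrow> real) \<Rightarrow> ('a \<Rightarrow>\<^sub>L 'a) \<Rightarrow> bool"
  where "polar g B J \<longleftrightarrow> (\<forall>v. g (J v) (J v) = g v v) \<and> inner_product (\<lambda>u v. B u (J v))"

lemma bilinear_compose_right:
  assumes "bilinear B"
  shows "bilinear (\<lambda>u v. B u (blinfun_apply J v))"
  using assms by (simp add: bilinear_def linear_iff blinfun.add_right blinfun.scaleR_right)

text \<open>Compare the two inner products at a vector \<open>w\<close> that maximises their ratio
  \<open>l\<close>. There \<open>J w = l *\<^sub>R K w\<close>, and since both maps are isometries,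
  \<open>l = 1\<close>. Exchanging \<open>J\<close> and \<open>K\<close> shows that the two
  quadratic forms agree.\<close>

lemma polar_unique:
  fixes g B :: "'a::euclidean_space \<Rightarrow> 'a \<Rightarrow> real"
  assumes g: "inner_product g" and B: "bilinear B"
    and nondeg: "\<And>v. (\<And>u. B u v = 0) \<Longrightarrow> v = 0"
    and "polar g B J" "polar g B K"
  shows "J = K"
proof -
  note g' = inner_productD[OF g]
  have le: "B v (J v) \<le> B v (K v)" if J: "polar g B J" and K: "polar g B K" for J K v
  proof -
    have hJ: "inner_product (\<lambda>u v. B u (J v))" and hK: "inner_product (\<lambda>u v. B u (K v))"
      and iso: "g (J v) (J v) = g (K v) (K v)" for v
      using J K by (auto simp: polar_def)
    obtain l w where w: "w \<noteq> 0" "B w (J w) = l * B w (K w)"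
      and l: "\<And>u. B u (J u) \<le> l * B u (K u)"
      by (rule bilinear_max_ratio[OF inner_productD(1)[OF hJ] hK]) (rule that)
    \<comment> \<open>By the choice of \<open>l\<close> this form is semidefinite with null vector
      \<open>w\<close>, so nondegeneracy of \<open>B\<close> applies to
      \<open>l *\<^sub>R K w - J w\<close>.\<close>
    let ?q = "\<lambda>u v. B u (l *\<^sub>R K v - J v)"
    have q: "?q u v = l * B u (K v) - B u (J v)" for u v
      using B by (simp add: bilinear_simps)
    have "?q u w = 0" for u
    proof (rule semidefinite_null_vector[of ?q])
      show "bilinear ?q"
        using bilinear_compose_right[OF B, of "l *\<^sub>R K - J"]
        by (simp add: blinfun.diff_left blinfun.scaleR_left)
      show "?q u v = ?q v u" for u v
        unfolding q using inner_productD(2)[OF hJ, of u v] inner_productD(2)[OF hK, of u v] by simp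
    qed (use w l in \<open>auto simp: q\<close>)
    then have "l *\<^sub>R K w - J w = 0" by (rule nondeg)
    then have "g (l *\<^sub>R K w) (l *\<^sub>R K w) = g (K w) (K w)"
      using iso[of w] by simp
    then have "l\<^sup>2 * g w w = g w w"
      using K by (simp add: bilinear_homogeneous[OF g'(1)] polar_def)
    then have "l\<^sup>2 = 1" using g'(5)[of w] w(1) by simp
    moreover have "l > 0"
      using inner_productD(3)[OF hJ w(1)] inner_productD(3)[OF hK w(1)] w(2)
      by (metis zero_less_mult_pos2)
    ultimately have "l = 1" by (simp add: power2_eq_1_iff)
    with l[of v] show ?thesis by simp
  qed
  \<comment> \<open>Every vector is null for this symmetric form, by the comparison in both
    directions, so the form is zero.\<close>
  let ?q = "\<lambda>u v. B u ((K - J) v)"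
  have hJ: "inner_product (\<lambda>u v. B u (J v))" and hK: "inner_product (\<lambda>u v. B u (K v))"
    using assms by (auto simp: polar_def)
  have q: "?q u v = B u (K v) - B u (J v)" for u v
    using B by (simp add: bilinear_simps blinfun.diff_left)
  have "?q u v = 0" for u v
  proof (rule semidefinite_null_vector[of ?q])
    show "bilinear ?q" by (rule bilinear_compose_right[OF B])
    show "?q u v = ?q v u" for u v
      unfolding q using inner_productD(2)[OF hJ, of u v] inner_productD(2)[OF hK, of u v] by simp
  qed (use le[of J K] le[of K J] assms in \<open>auto simp: q intro: antisym\<close>)
  then have "(K - J) v = 0" for v by (rule nondeg)
  then show ?thesis by (intro blinfun_eqI) (simp add: blinfun.diff_left)
qed

text \<open>Definiteness is automatic: nondegeneracy of \<open>B\<close> would make \<open>J\<close>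
  kill a null vector, but isometries are injective. Thus only weak inequalities, which survive
  limits and come out of maximality, have to be checked.\<close>

lemma polarI_semidefinite:
  fixes g B :: "'a::euclidean_space \<Rightarrow> 'a \<Rightarrow> real" and J :: "'a \<Rightarrow>\<^sub>L 'a"
  assumes g: "inner_product g" and B: "bilinear B"
    and nondeg: "\<And>v. (\<And>u. B u v = 0) \<Longrightarrow> v = 0"
    and iso: "\<And>v. g (J v) (J v) = g v v"
    and sym: "\<And>u v. B u (J v) = B v (J u)" and nonneg: "\<And>v. B v (J v) \<ge> 0"
  shows "polar g B J"
proof -
  have "B v (J v) \<noteq> 0" if "v \<noteq> 0" for v
  proof
    assume "B v (J v) = 0"
    then have "B u (J v) = 0" for u
      by (rule semidefinite_null_vector[OF bilinear_compose_right[OF B] sym nonneg])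
    then have "J v = 0" by (rule nondeg)
    with iso[of v] have "g v v = 0" using inner_productD(5)[OF g, of 0] by simp
    with that show False using inner_productD(5)[OF g] by simp
  qed
  with nonneg have "B v (J v) > 0" if "v \<noteq> 0" for v
    using that by (simp add: order_less_le)
  with iso sym bilinear_compose_right[OF B, of J] show ?thesis
    by (auto simp: polar_def inner_product_def)
qed

text \<open>Since \<open>x / 0 = 0\<close>, the reflection in \<open>n = 0\<close> is the identity, which is still an isometry.\<close>

definition reflection :: "('a::euclidean_space \<Rightarrow> 'a \<Rightarrow> real) \<Rightarrow> 'a \<Rightarrow> 'a \<Rightarrow> 'a"
  where "reflection g n v = v - (2 * g n v / g n n) *\<^sub>R n"

lemma linear_reflection: "inner_product g \<Longrightarrow> linear (reflection g n)"
  by (intro linearI) (simp_all add: reflection_def bilinear_simps inner_productD(1)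
      algebra_simps add_divide_distrib)

lemma reflection_isometry:
  assumes "inner_product g"
  shows "g (reflection g n v) (reflection g n v) = g v v"
  using inner_productD[OF assms] inner_productD(2)[OF assms, of v n]
  by (cases "n = 0") (auto simp: reflection_def bilinear_simps field_simps)

text \<open>Comparing \<open>g\<close> with the norm bounds every isometry, and each isometry
  condition is closed.\<close>

lemma compact_isometries:
  fixes g :: "'a::euclidean_space \<Rightarrow> 'a \<Rightarrow> real"
  assumes "inner_product g"
  shows "compact {J :: 'a \<Rightarrow>\<^sub>L 'a. \<forall>v. g (J v) (J v) = g v v}" (is "compact ?O")
proof -
  obtain c D where cD: "c > 0" "D > 0" "\<And>v. c * (norm v)\<^sup>2 \<le> g v v" "\<And>v. g v v \<le> D * (norm v)\<^sup>2"
    by (rule inner_product_bounds[OF assms]) (rule that)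
  have "norm J \<le> sqrt (D / c)" if "J \<in> ?O" for J
  proof (rule norm_blinfun_bound)
    fix v
    have "c * (norm (J v))\<^sup>2 \<le> D * (norm v)\<^sup>2"
      using cD(3)[of "J v"] cD(4)[of v] that by auto
    then have "(norm (J v))\<^sup>2 \<le> (sqrt (D / c) * norm v)\<^sup>2"
      using cD(1,2) by (simp add: power_mult_distrib field_simps)
    then show "norm (J v) \<le> sqrt (D / c) * norm v"
      by (rule power2_le_imp_le) (use cD in auto)
  qed (use cD in auto)
  then have "bounded ?O" by (auto simp: bounded_iff)
  moreover have "closed ?O"
  proof -
    have "closed {J. g (blinfun_apply J v) (blinfun_apply J v) = g v v}" for v
      by (intro closed_Collect_eq bilinear_continuous_on_compose[OF _ _ inner_productD(1)[OF assms]]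
          continuous_intros)
    then show ?thesis by (simp add: closed_Collect_all)
  qed
  ultimately show ?thesis by (simp add: compact_eq_bounded_closed)
qed

text \<open>A reflection differs from the identity by a rank-one map of this shape, so this tells
  how composing with it changes a trace.\<close>

lemma trace_rank_one:
  fixes g :: "'a::euclidean_space \<Rightarrow> 'a \<Rightarrow> real"
  assumes "bilinear g"
  shows "(\<Sum>i\<in>Basis. i \<bullet> (g n i *\<^sub>R w)) = g n w"
proof -
  have "linear (g n)" using assms by (simp add: bilinear_def)
  then have "g n (\<Sum>i\<in>Basis. (w \<bullet> i) *\<^sub>R i) = (\<Sum>i\<in>Basis. (w \<bullet> i) *\<^sub>R g n i)"
    by (subst linear_sum) (auto simp: linear_cmul)
  then have "g n w = (\<Sum>i\<in>Basis. (w \<bullet> i) * g n i)"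
    by (simp add: euclidean_representation)
  then show ?thesis by (simp add: mult.commute inner_commute[of w])
qed

text \<open>
  Writing \<open>B u v = g u (C v)\<close>, take the isometry \<open>J\<close> that maximises the trace of \<open>M = C \<circ> J\<close>.
  Composing \<open>J\<close> with one reflection shows that \<open>M\<close> is semidefinite; composing it with a product
  of two reflections in nearby vectors shows that \<open>M\<close> is symmetric.
\<close>

lemma polar_exists:
  fixes g B :: "'a::euclidean_space \<Rightarrow> 'a \<Rightarrow> real"
  assumes g: "inner_product g" and B: "bilinear B"
    and nondeg: "\<And>v. (\<And>u. B u v = 0) \<Longrightarrow> v = 0"
  obtains J where "polar g B J"
proof -
  note g' = inner_productD[OF g]
  let ?O = "{J :: 'a \<Rightarrow>\<^sub>L 'a. \<forall>v. g (J v) (J v) = g v v}"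
  obtain C where C: "linear C" "\<And>u v. g u (C v) = B u v"
    by (rule inner_product_representation[OF g B]) (rule that)
  define tr where "tr L = (\<Sum>i\<in>Basis. i \<bullet> L i)" for L :: "'a \<Rightarrow> 'a"
  have tr_simps: "tr (\<lambda>v. L v - L' v) = tr L - tr L'"
    "tr (\<lambda>v. c *\<^sub>R L v) = c * tr L"
    "tr (\<lambda>v. g n v *\<^sub>R w) = g n w" for L L' c n w
    using trace_rank_one[OF g'(1), of n w]
    by (simp_all add: tr_def inner_diff_right sum_subtractf sum_distrib_left)
  have "bounded_linear C" using C(1) by (simp add: linear_conv_bounded_linear)
  then have "continuous_on ?O (\<lambda>J. C (blinfun_apply J i))" for i
    by (rule bounded_linear.continuous_on) (intro continuous_intros)
  then have cont: "continuous_on ?O (\<lambda>J. tr (\<lambda>v. C (J v)))"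
    unfolding tr_def by (intro continuous_on_sum continuous_on_inner continuous_on_const)
  have "id_blinfun \<in> ?O" by simp
  then have nonempty: "?O \<noteq> {}" by blast
  obtain J where J: "J \<in> ?O"
    and max: "\<And>K. K \<in> ?O \<Longrightarrow> tr (\<lambda>v. C (K v)) \<le> tr (\<lambda>v. C (J v))"
    using continuous_attains_sup[OF compact_isometries[OF g] nonempty cont] by blast
  define M where "M v = C (J v)" for v
  have M: "linear M"
    unfolding M_def using linear_compose[OF bounded_linear.linear[OF blinfun.bounded_linear_right] C(1), of J] by (simp add: o_def)
  \<comment> \<open>Following the isometry \<open>R\<close> by \<open>J\<close> gives a competitor
    for the maximum.\<close>
  have max': "tr (\<lambda>v. M (R v)) \<le> tr M" if "linear R" "\<And>v. g (R v) (R v) = g v v" for R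
  proof -
    have "bounded_linear R" using that(1) by (simp add: linear_conv_bounded_linear)
    then have "blinfun_apply (J o\<^sub>L Blinfun R) v = J (R v)" for v
      by (simp add: bounded_linear_Blinfun_apply)
    moreover from this have "J o\<^sub>L Blinfun R \<in> ?O" using J that(2) by simp
    ultimately show ?thesis using max[of "J o\<^sub>L Blinfun R"] by (simp add: M_def[abs_def])
  qed
  \<comment> \<open>The rank-one term keeps its scalar apart so that \<open>tr_simps\<close>
    evaluates its trace.\<close>
  have M_refl: "M (reflection g n v) = M v - (2 / g n n) *\<^sub>R (g n v *\<^sub>R M n)" for n v
    using M by (simp add: reflection_def linear_diff linear_cmul)
  have nonneg: "g n (M n) \<ge> 0" for n
  proof (cases "n = 0")
    case True
    then show ?thesis using g'(1) by (simp add: bilinear_lzero)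
  next
    case False
    have "tr (\<lambda>v. M (reflection g n v)) \<le> tr M"
      by (intro max' linear_reflection reflection_isometry g)
    then have "tr M - 2 / g n n * g n (M n) \<le> tr M"
      by (simp only: M_refl tr_simps)
    then show ?thesis using g'(3)[OF False] by (simp add: zero_le_mult_iff zero_le_divide_iff)
  qed
  have two: "2 * g n m * g m (M n) \<le> g m m * g n (M n) + g n n * g m (M m)" for n m
  proof (cases "n = 0 \<or> m = 0")
    case True
    then show ?thesis using g'(1) M by (auto simp: bilinear_lzero bilinear_rzero linear_0)
  next
    case False
    then have pos: "g n n > 0" "g m m > 0" using g'(3) by auto
    have "tr (\<lambda>v. M ((reflection g n \<circ> reflection g m) v)) \<le> tr M"
      by (intro max' linear_compose linear_reflection g)
        (simp add: reflection_isometry[OF g])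
    moreover have "M ((reflection g n \<circ> reflection g m) v) =
        M v - (2 / g m m) *\<^sub>R (g m v *\<^sub>R M m) -
        ((2 / g n n) *\<^sub>R (g n v *\<^sub>R M n) - (4 * g n m / (g n n * g m m)) *\<^sub>R (g m v *\<^sub>R M n))" for v
      using g'(1) unfolding o_def M_refl
      by (simp add: reflection_def bilinear_simps algebra_simps)
    ultimately have "tr M - 2 / g m m * g m (M m) -
        (2 / g n n * g n (M n) - 4 * g n m / (g n n * g m m) * g m (M n)) \<le> tr M"
      by (simp only: tr_simps)
    then have "(4 * g n m * g m (M n)) / (g n n * g m m) \<le>
        2 / g m m * g m (M m) + 2 / g n n * g n (M n)"
      by simp
    also have "\<dots> = (2 * (g m m * g n (M n) + g n n * g m (M m))) / (g n n * g m m)"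
      using pos by (simp add: field_simps)
    finally have "4 * g n m * g m (M n) \<le> 2 * (g m m * g n (M n) + g n n * g m (M m))"
      using pos by (simp only: divide_le_cancel) auto
    then show ?thesis by simp
  qed
  have "g p (M n) = g n (M p)" for n p
  proof (cases "n = 0")
    case True
    then show ?thesis using g'(1) M by (auto simp: bilinear_lzero bilinear_rzero linear_0)
  next
    case False
    \<comment> \<open>Taking \<open>m = n + s *\<^sub>R p\<close> in \<open>two\<close> gives
      equality at \<open>s = 0\<close>, so the first-order term in \<open>s\<close>, which measures
      the asymmetry of \<open>M\<close>, must vanish.\<close>
    have "s * (g n n * (g p (M n) - g n (M p))) \<le>
        s\<^sup>2 * (g p p * g n (M n) + g n n * g p (M p) - 2 * g n p * g p (M n))" for s
      using two[of n "n + s *\<^sub>R p"] g'(1) M g'(2)[of p n]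
      by (simp add: bilinear_simps linear_add linear_cmul power2_eq_square algebra_simps)
    from linear_coeff_eq_0_if_dominated[OF this] show ?thesis
      using g'(3)[OF False] by simp
  qed
  then have "polar g B J"
    using J nonneg by (intro polarI_semidefinite[OF g B nondeg]) (auto simp: M_def C(2))
  then show ?thesis using that by blast
qed

section \<open>Cosymplectic structures\<close>

text \<open>Dropping the mixed terms of \<open>g\<close> makes the map that is \<open>-1\<close> on
  \<open>ker \<psi>\<close> and \<open>1\<close> on the Reeb line an isometry, as
  \<open>polar_cocomplex_square\<close> requires.\<close>

definition split_metric :: "('a::euclidean_space \<Rightarrow>\<^sub>L 'a \<Rightarrow>\<^sub>L real) \<Rightarrow> ('a \<Rightarrow>\<^sub>L real) \<Rightarrow>
    ('a \<Rightarrow>\<^sub>L 'a \<Rightarrow>\<^sub>L real) \<Rightarrow> 'a \<Rightarrow> 'a \<Rightarrow> real"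
  where "split_metric b \<psi> g u v = g (proj1 b \<psi> u) (proj1 b \<psi> v) + \<psi> u * \<psi> v"

definition polar_cocomplex :: "('a::euclidean_space \<Rightarrow>\<^sub>L 'a \<Rightarrow>\<^sub>L real) \<Rightarrow> ('a \<Rightarrow>\<^sub>L real) \<Rightarrow>
    ('a \<Rightarrow>\<^sub>L 'a \<Rightarrow>\<^sub>L real) \<Rightarrow> ('a \<Rightarrow>\<^sub>L 'a)"
  where "polar_cocomplex b \<psi> g = (THE J. polar (split_metric b \<psi> g) (\<lambda>u. flat b \<psi> u) J)"

lemma linear_proj1: "linear (proj1 b \<psi>)"
  by (intro linearI) (simp_all add: proj1_def blinfun.bilinear_simps algebra_simps)

lemma bilinear_flat: "bilinear (\<lambda>u. blinfun_apply (flat b \<psi> u))"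
  by (simp add: bilinear_def linear_iff flat_apply blinfun.bilinear_simps algebra_simps)

lemma cosymplectic_skew: "cosymplectic b \<psi> \<Longrightarrow> b u v = - b v u"
  unfolding cosymplectic_def by blast

lemma flat_flip:
  assumes "cosymplectic b \<psi>"
  shows "flat b \<psi> v u = - flat b \<psi> u v + 2 * \<psi> u * \<psi> v"
  using cosymplectic_skew[OF assms, of v u] by (simp add: flat_apply)

text \<open>Injectivity of \<open>flat b \<psi>\<close> concerns the first argument. Pairing with
  the Reeb vector gives \<open>\<psi> v = 0\<close>, and then \<open>flat_flip\<close> exchanges the
  arguments up to sign.\<close>

lemma flat_nondegenerate:
  assumes "cosymplectic b \<psi>" "\<And>u. flat b \<psi> u v = 0"
  shows "v = 0"
proof -
  have \<psi>: "\<psi> v = 0"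
    using assms(2)[of "reeb b \<psi>"] reeb_props[OF assms(1)] by (simp add: flat_apply)
  have "flat b \<psi> v = flat b \<psi> 0"
  proof (rule blinfun_eqI)
    fix u
    show "flat b \<psi> v u = flat b \<psi> 0 u"
      using flat_flip[OF assms(1), of v u] assms(2)[of u] \<psi> by (simp add: flat_apply)
  qed
  moreover have "inj (flat b \<psi>)"
    using assms(1) unfolding cosymplectic_def by (simp add: bij_is_inj)
  ultimately show ?thesis by (auto dest: injD)
qed

lemma inner_product_split_metric:
  assumes "g \<in> Riem"
  shows "inner_product (split_metric b \<psi> g)"
proof -
  have g: "inner_product (\<lambda>u. blinfun_apply (blinfun_apply g u))"
    using assms by (simp add: Riem_def)
  note g' = inner_productD[OF g]
  have "split_metric b \<psi> g v v > 0" if "v \<noteq> 0" for v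
  proof (cases "\<psi> v = 0")
    case True
    then show ?thesis using g'(3)[OF that] by (simp add: split_metric_def proj1_def)
  next
    case False
    then have "\<psi> v * \<psi> v > 0"
      using not_real_square_gt_zero by blast
    then show ?thesis
      using g'(4)[of "proj1 b \<psi> v"] by (simp add: split_metric_def add_nonneg_pos)
  qed
  moreover have "split_metric b \<psi> g u v = split_metric b \<psi> g v u" for u v
    using g'(2) by (simp add: split_metric_def mult.commute)
  ultimately show ?thesis
    by (auto simp: inner_product_def bilinear_def linear_iff split_metric_def blinfun.bilinear_simps
        linear_add[OF linear_proj1] linear_cmul[OF linear_proj1] algebra_simps)
qed

lemma polar_flat_unique:
  assumes "cosymplectic b \<psi>" "g \<in> Riem"
    "polar (split_metric b \<psi> g) (\<lambda>u. flat b \<psi> u) J" "polar (split_metric b \<psi> g) (\<lambda>u. flat b \<psi> u) K"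
  shows "J = K"
  using polar_unique[OF inner_product_split_metric[OF assms(2)] bilinear_flat
      flat_nondegenerate[OF assms(1)] assms(3,4)] .

lemma polar_cocomplex_polar:
  assumes "cosymplectic b \<psi>" "g \<in> Riem"
  shows "polar (split_metric b \<psi> g) (\<lambda>u. flat b \<psi> u) (polar_cocomplex b \<psi> g)"
proof -
  obtain J where J: "polar (split_metric b \<psi> g) (\<lambda>u. flat b \<psi> u) J"
    by (rule polar_exists[OF inner_product_split_metric[OF assms(2), of b \<psi>] bilinear_flat[of b \<psi>]])
      (rule flat_nondegenerate[OF assms(1)], blast, rule that)
  show ?thesis
    unfolding polar_cocomplex_def using J by (rule theI) (rule polar_flat_unique[OF assms _ J])
qed

lemma polar_cocomplex_eqI:
  assumes "cosymplectic b \<psi>" "g \<in> Riem" "polar (split_metric b \<psi> g) (\<lambda>u. flat b \<psi> u) J"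
  shows "polar_cocomplex b \<psi> g = J"
  using polar_flat_unique[OF assms(1,2) polar_cocomplex_polar[OF assms(1,2)] assms(3)] .

lemma blinfun_inverse:
  fixes f :: "'a::euclidean_space \<Rightarrow>\<^sub>L 'a"
  assumes "inj (blinfun_apply f)"
  obtains h :: "'a \<Rightarrow>\<^sub>L 'a" where "\<And>v. f (h v) = v" "\<And>v. h (f v) = v"
proof -
  obtain h where h: "linear h" "\<And>v. h (f v) = v" "\<And>v. f (h v) = v"
    using linear_injective_isomorphism[OF bounded_linear.linear[OF blinfun.bounded_linear_right] assms] by blast
  then have "blinfun_apply (Blinfun h) = h"
    by (simp add: bounded_linear_Blinfun_apply linear_conv_bounded_linear)
  with h that[of "Blinfun h"] show ?thesis by simp
qed

lemma polar_cocomplex_square: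
  assumes cos: "cosymplectic b \<psi>" and g: "g \<in> Riem"
  defines "J \<equiv> polar_cocomplex b \<psi> g"
  shows "J (J v) = proj2 b \<psi> v - proj1 b \<psi> v"
proof -
  note \<xi> = reeb_props[OF cos]
  have iso: "split_metric b \<psi> g (J v) (J v) = split_metric b \<psi> g v v"
    and h: "inner_product (\<lambda>u v. flat b \<psi> u (J v))" for v
    using polar_cocomplex_polar[OF cos g] by (auto simp: J_def polar_def)
  have "J v = 0 \<Longrightarrow> v = 0" for v
    using inner_productD(5)[OF h, of v] by simp
  then have "inj (blinfun_apply J)"
    by (simp add: linear_injective_0[OF bounded_linear.linear[OF blinfun.bounded_linear_right]])
  then obtain K :: "'a \<Rightarrow>\<^sub>L 'a" where K: "\<And>v. J (K v) = v" "\<And>v. K (J v) = v"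
    by (rule blinfun_inverse) (rule that)
  define S where "S v = proj2 b \<psi> v - proj1 b \<psi> v" for v
  have S: "linear S"
    by (intro linearI) (simp_all add: S_def proj1_def proj2_def blinfun.bilinear_simps algebra_simps)
  \<comment> \<open>Once \<open>L = J\<close> is known by uniqueness,
    \<open>J \<circ> J = S \<circ> K \<circ> J = S\<close>.\<close>
  define L where "L = Blinfun S o\<^sub>L K"
  have L: "L v = S (K v)" for v
    using S by (simp add: L_def bounded_linear_Blinfun_apply linear_conv_bounded_linear)
  have "proj1 b \<psi> (S v) = - proj1 b \<psi> v" "\<psi> (S v) = \<psi> v" for v
    using \<xi> by (simp_all add: S_def proj1_def proj2_def blinfun.bilinear_simps)
  then have "split_metric b \<psi> g (S v) (S v) = split_metric b \<psi> g v v" for v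
    by (simp add: split_metric_def blinfun.bilinear_simps)
  moreover have "split_metric b \<psi> g (K v) (K v) = split_metric b \<psi> g v v" for v
    using iso[of "K v"] by (simp add: K)
  moreover have flat_S: "flat b \<psi> u (S v) = flat b \<psi> v u" for u v
  proof -
    have "b u (reeb b \<psi>) = 0" and "b v u = - b u v"
      using cosymplectic_skew[OF cos, of u "reeb b \<psi>"] cosymplectic_skew[OF cos, of v u] \<xi>(2)
      by simp_all
    then show ?thesis
      using \<xi>(1) by (simp add: flat_apply S_def proj1_def proj2_def blinfun.bilinear_simps)
  qed
  \<comment> \<open>By \<open>flat_S\<close> the left side is \<open>flat b \<psi> (K v) u\<close>,
    and \<open>u = J (K u)\<close>. So the form of \<open>L\<close> is that of \<open>J\<close>
    pulled back along \<open>K\<close>, with arguments exchanged.\<close>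
  have "flat b \<psi> u (L v) = flat b \<psi> (K v) (J (K u))" for u v
    by (simp add: L flat_S K)
  moreover have "inner_product (\<lambda>u v. flat b \<psi> (K v) (J (K u)))"
  proof -
    have "K v = 0 \<Longrightarrow> v = 0" for v using K(1)[of v] by simp
    then show ?thesis
      using inner_productD[OF h]
      by (auto simp: inner_product_def bilinear_def linear_iff blinfun.bilinear_simps)
  qed
  ultimately have "polar (split_metric b \<psi> g) (\<lambda>u. flat b \<psi> u) L"
    by (simp add: polar_def L)
  then have "J = L"
    unfolding J_def by (rule polar_cocomplex_eqI[OF cos g])
  then have "J (J v) = S (K (J v))" by (simp add: L)
  then show ?thesis by (simp add: K S_def)
qed

lemma polar_cocomplex_in_compatible:
  assumes "cosymplectic b \<psi>" "g \<in> Riem"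
  shows "polar_cocomplex b \<psi> g \<in> compatible_cocomplex b \<psi>"
  using polar_cocomplex_polar[OF assms] polar_cocomplex_square[OF assms] reeb_props[OF assms(1)]
  by (auto simp: compatible_cocomplex_def cocomplex_def compatible_def polar_def ker_def
      span_singleton proj1_def proj2_def blinfun.bilinear_simps)

text \<open>The co-complex conditions restrict only the diagonal blocks of
  \<open>J \<circ> J\<close>, so compatibility must rule out a component \<open>w\<close> of
  \<open>J (reeb b \<psi>)\<close> in \<open>ker \<psi>\<close>. It is shown that
  \<open>\<psi> (J (J w))\<close> annihilates \<open>w\<close> and is minus the squared length of
  \<open>w\<close>.\<close>

lemma compatible_cocomplex_reeb:
  assumes cos: "cosymplectic b \<psi>" and J: "J \<in> compatible_cocomplex b \<psi>"
  shows "J (reeb b \<psi>) = reeb b \<psi>" "\<psi> (J v) = \<psi> v"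
proof -
  let ?\<xi> = "reeb b \<psi>"
  note \<xi> = reeb_props[OF cos]
  have h: "inner_product (\<lambda>u v. flat b \<psi> u (J v))"
    and ker: "\<And>v. \<psi> v = 0 \<Longrightarrow> proj1 b \<psi> (J (J v)) = - v"
    and xi: "proj2 b \<psi> (J (J ?\<xi>)) = ?\<xi>"
    using J by (auto simp: compatible_cocomplex_def compatible_def cocomplex_def ker_def span_base)
  note skew = cosymplectic_skew[OF cos]
  \<comment> \<open>This is the symmetry of the compatible inner product for the pair
    \<open>?\<xi>\<close>, \<open>v\<close>.\<close>
  have \<psi>J: "\<psi> (J v) = b v (J ?\<xi>) + \<psi> v * \<psi> (J ?\<xi>)" for v
    using inner_productD(2)[OF h, of ?\<xi> v] \<xi> by (simp add: flat_apply)
  have "?\<xi> \<noteq> 0" using \<xi>(1) by auto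
  then have "\<psi> (J ?\<xi>) > 0"
    using inner_productD(3)[OF h, of ?\<xi>] \<xi> by (simp add: flat_apply)
  moreover have "\<psi> (J ?\<xi>) * \<psi> (J ?\<xi>) = 1"
  proof -
    have "\<psi> (proj2 b \<psi> (J (J ?\<xi>))) = 1" using xi \<xi> by simp
    then show ?thesis
      using \<psi>J[of "J ?\<xi>"] skew[of "J ?\<xi>" "J ?\<xi>"] \<xi> by (simp add: proj2_def blinfun.bilinear_simps)
  qed
  ultimately have one: "\<psi> (J ?\<xi>) = 1"
    by (simp add: flip: power2_eq_square add: power2_eq_1_iff)
  define w where "w = J ?\<xi> - ?\<xi>"
  have J\<xi>: "J ?\<xi> = ?\<xi> + w" by (simp add: w_def)
  have b\<xi>: "b v ?\<xi> = 0" for v using skew[of v ?\<xi>] \<xi> by simp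
  have \<psi>J: "\<psi> (J v) = b v w + \<psi> v" for v
    using \<psi>J[of v] one b\<xi> by (simp add: J\<xi> blinfun.bilinear_simps)
  have \<psi>w: "\<psi> w = 0" using one \<xi> by (simp add: w_def blinfun.bilinear_simps)
  have \<psi>Jw: "\<psi> (J w) = 0" using \<psi>J[of w] skew[of w w] \<psi>w by simp
  have "J (J w) = - w + \<psi> (J (J w)) *\<^sub>R ?\<xi>"
    using ker[OF \<psi>w] by (simp add: proj1_def algebra_simps)
  \<comment> \<open>The \<open>ker \<psi>\<close> part of \<open>J (J (J w))\<close> is computed
    twice: by applying \<open>J\<close> to \<open>J (J w)\<close>, and from the co-complex condition
    at \<open>J w\<close>.\<close>
  then have "J (J (J w)) = J (- w + \<psi> (J (J w)) *\<^sub>R ?\<xi>)" by simp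
  also have "\<dots> = - J w + \<psi> (J (J w)) *\<^sub>R (?\<xi> + w)"
    by (simp only: blinfun.bilinear_simps J\<xi>)
  finally have "proj1 b \<psi> (J (J (J w))) = proj1 b \<psi> (- J w + \<psi> (J (J w)) *\<^sub>R (?\<xi> + w))"
    by simp
  also have "\<dots> = - J w + \<psi> (J (J w)) *\<^sub>R w"
    using \<psi>Jw \<xi> \<psi>w by (simp add: proj1_def blinfun.bilinear_simps algebra_simps)
  finally have "\<psi> (J (J w)) *\<^sub>R w = 0"
    unfolding ker[OF \<psi>Jw] by simp
  moreover have "\<psi> (J (J w)) = - flat b \<psi> w (J w)"
    using \<psi>J[of "J w"] skew[of "J w" w] \<psi>w \<psi>Jw by (simp add: flat_apply)
  ultimately have "w = 0"
    using inner_productD(5)[OF h, of w] by auto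
  then show "J ?\<xi> = ?\<xi>" "\<psi> (J v) = \<psi> v"
    using J\<xi> \<psi>J[of v] by simp_all
qed

lemma compatible_cocomplex_in_range:
  assumes cos: "cosymplectic b \<psi>" and J: "J \<in> compatible_cocomplex b \<psi>"
  shows "J \<in> polar_cocomplex b \<psi> ` Riem"
proof -
  note \<xi> = reeb_props[OF cos] and J\<xi> = compatible_cocomplex_reeb[OF cos J]
  have h: "inner_product (\<lambda>u v. flat b \<psi> u (J v))"
    and ker: "\<And>v. \<psi> v = 0 \<Longrightarrow> proj1 b \<psi> (J (J v)) = - v"
    using J by (auto simp: compatible_cocomplex_def compatible_def cocomplex_def ker_def)
  define g where "g = Blinfun (\<lambda>u. flat b \<psi> u o\<^sub>L J)"
  have "linear (\<lambda>u. flat b \<psi> u o\<^sub>L J)"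
    by (intro linearI blinfun_eqI) (simp_all add: flat_apply blinfun.bilinear_simps algebra_simps)
  then have g: "g u v = flat b \<psi> u (J v)" for u v
    by (simp add: g_def bounded_linear_Blinfun_apply linear_conv_bounded_linear)
  have "(\<lambda>u. blinfun_apply (g u)) = (\<lambda>u v. flat b \<psi> u (J v))"
    by (simp add: fun_eq_iff g)
  then have "g \<in> Riem" using h by (simp add: Riem_def)
  moreover have "split_metric b \<psi> g (J v) (J v) = split_metric b \<psi> g v v" for v
  proof -
    define k where "k = proj1 b \<psi> v"
    have \<psi>k: "\<psi> k = 0" using \<xi> by (simp add: k_def proj1_def blinfun.bilinear_simps)
    have "proj1 b \<psi> (J v) = J k"
      by (simp add: k_def proj1_def J\<xi> blinfun.bilinear_simps)
    moreover have "J (J k) = - k"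
      using ker[OF \<psi>k] by (simp add: proj1_def J\<xi> \<psi>k)
    \<comment> \<open>The left side is \<open>- flat b \<psi> (J k) k\<close>, and the form is skew
      here because \<open>\<psi> k = 0\<close>.\<close>
    then have "g (J k) (J k) = g k k"
      using flat_flip[OF cos, of "J k" k] \<psi>k by (simp add: g blinfun.bilinear_simps)
    ultimately show ?thesis
      by (simp add: split_metric_def J\<xi> flip: k_def)
  qed
  ultimately show ?thesis
    using polar_cocomplex_eqI[OF cos, of g J] h by (auto simp: polar_def)
qed

text \<open>An isomorphism preserves the Reeb vector, hence the split metric, so conjugating the
  polar factor on the target gives a polar factor on the source; uniqueness identifies the
  two.\<close>

lemma canonical_polar_cocomplex: "canonical polar_cocomplex"
  unfolding canonical_def
proof (intro allI impI)
  fix b :: "'a \<Rightarrow>\<^sub>L 'a \<Rightarrow>\<^sub>L real" and \<psi> b' \<psi>' \<phi> g g' v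
  assume cos: "cosymplectic b \<psi>" "cosymplectic b' \<psi>'" and iso: "cosymplectic_iso b \<psi> b' \<psi>' \<phi>"
    and g: "g \<in> Riem" "g' \<in> Riem" "\<forall>u v. g' (\<phi> u) (\<phi> v) = g u v"
  note \<xi> = reeb_props[OF cos(1)]
  have \<phi>: "bij (blinfun_apply \<phi>)" "b' (\<phi> u) (\<phi> v) = b u v" "\<psi>' (\<phi> v) = \<psi> v" for u v
    using iso by (auto simp: cosymplectic_iso_def)
  obtain \<theta> :: "'a \<Rightarrow>\<^sub>L 'a" where \<theta>: "\<phi> (\<theta> v) = v" "\<theta> (\<phi> v) = v" for v
    by (rule blinfun_inverse[OF bij_is_inj[OF \<phi>(1)]]) (rule that)
  have "b' (\<phi> (reeb b \<psi>)) = 0"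
  proof (rule blinfun_eqI)
    fix u show "b' (\<phi> (reeb b \<psi>)) u = blinfun_apply 0 u"
      using \<phi>(2)[of "reeb b \<psi>" "\<theta> u"] \<xi> by (simp add: \<theta>)
  qed
  then have "\<phi> (reeb b \<psi>) = reeb b' \<psi>'"
    using reeb_ex1[OF cos(2)] reeb_props[OF cos(2)] \<phi>(3)[of "reeb b \<psi>"] \<xi> by auto
  then have "proj1 b' \<psi>' (\<phi> u) = \<phi> (proj1 b \<psi> u)" for u
    by (simp add: proj1_def \<phi>(3) blinfun.bilinear_simps)
  then have metric: "split_metric b' \<psi>' g' (\<phi> u) (\<phi> v) = split_metric b \<psi> g u v" for u v
    using g(3) by (simp add: split_metric_def \<phi>(3))
  have flat: "flat b' \<psi>' (\<phi> u) (\<phi> v) = flat b \<psi> u v" for u v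
    by (simp add: flat_apply \<phi>(2,3))
  define J' where "J' = polar_cocomplex b' \<psi>' g'"
  have J': "split_metric b' \<psi>' g' (J' v) (J' v) = split_metric b' \<psi>' g' v v"
    "inner_product (\<lambda>u v. flat b' \<psi>' u (J' v))" for v
    using polar_cocomplex_polar[OF cos(2) g(2)] by (auto simp: J'_def polar_def)
  have "polar (split_metric b \<psi> g) (\<lambda>u. flat b \<psi> u) (\<theta> o\<^sub>L J' o\<^sub>L \<phi>)"
  proof -
    have "\<phi> v = 0 \<Longrightarrow> v = 0" for v using \<theta>(2)[of v] by simp
    then have "inner_product (\<lambda>u v. flat b' \<psi>' (\<phi> u) (J' (\<phi> v)))"
      using inner_productD[OF J'(2)]
      by (auto simp: inner_product_def bilinear_def linear_iff blinfun.bilinear_simps)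
    moreover have "flat b' \<psi>' (\<phi> u) (J' (\<phi> v)) = flat b \<psi> u (\<theta> (J' (\<phi> v)))" for u v
      using flat[of u "\<theta> (J' (\<phi> v))"] by (simp add: \<theta>)
    moreover have "split_metric b \<psi> g (\<theta> (J' (\<phi> v))) (\<theta> (J' (\<phi> v))) = split_metric b \<psi> g v v" for v
      using metric[of "\<theta> (J' (\<phi> v))" "\<theta> (J' (\<phi> v))"] metric[of v v] J'(1)[of "\<phi> v"]
      by (simp add: \<theta>)
    ultimately show ?thesis by (simp add: polar_def)
  qed
  then have "polar_cocomplex b \<psi> g = \<theta> o\<^sub>L J' o\<^sub>L \<phi>"
    by (rule polar_cocomplex_eqI[OF cos(1) g(1)])
  then show "polar_cocomplex b' \<psi>' g' (\<phi> v) = \<phi> (polar_cocomplex b \<psi> g v)"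
    by (simp add: \<theta> flip: J'_def)
qed

section \<open>Continuity\<close>

text \<open>If values stayed away from \<open>f x\<close> along a subsequence, local compactness
  would give a further subsequence with convergent values, whose limit is \<open>f x\<close> by
  closedness of the graph.\<close>

lemma continuous_on_if_closed_graph_locally_compact:
  fixes f :: "'a::metric_space \<Rightarrow> 'b::metric_space"
  assumes bdd: "\<And>x. x \<in> S \<Longrightarrow> \<exists>e>0. \<exists>K. compact K \<and> (\<forall>y\<in>S. dist y x < e \<longrightarrow> f y \<in> K)"
    and closed: "\<And>X x y. \<lbrakk>x \<in> S; \<And>n. X n \<in> S; X \<longlonglongrightarrow> x; (\<lambda>n. f (X n)) \<longlonglongrightarrow> y\<rbrakk> \<Longrightarrow> y = f x"
  shows "continuous_on S f"
  unfolding continuous_on_sequentially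
proof (intro allI ballI impI)
  fix X x
  assume x: "x \<in> S" and X: "(\<forall>n. X n \<in> S) \<and> X \<longlonglongrightarrow> x"
  show "(f \<circ> X) \<longlonglongrightarrow> f x"
  proof (rule ccontr)
    assume "\<not> (f \<circ> X) \<longlonglongrightarrow> f x"
    then obtain d where d: "d > 0" "\<exists>\<^sub>F n in sequentially. \<not> dist (f (X n)) (f x) < d"
      by (auto simp: tendsto_iff frequently_def)
    obtain e K where e: "e > 0" "compact K" "\<And>y. y \<in> S \<Longrightarrow> dist y x < e \<Longrightarrow> f y \<in> K"
      using bdd[OF x] by blast
    have "\<forall>\<^sub>F n in sequentially. dist (X n) x < e"
      using X e(1) by (auto simp: tendsto_iff)
    from frequently_eventually_frequently[OF d(2) this]
    have "infinite {n. \<not> dist (f (X n)) (f x) < d \<and> dist (X n) x < e}"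
      by (simp add: frequently_cofinite flip: cofinite_eq_sequentially)
    from infinite_enumerate[OF this] obtain r :: "nat \<Rightarrow> nat" where r: "strict_mono r"
      and "\<forall>n. r n \<in> {n. \<not> dist (f (X n)) (f x) < d \<and> dist (X n) x < e}"
      by blast
    then have rn: "\<not> dist (f (X (r n))) (f x) < d" "f (X (r n)) \<in> K" for n
      using e(3) X by auto
    have "\<exists>y\<in>K. \<exists>s. strict_mono s \<and> ((\<lambda>n. f (X (r n))) \<circ> s) \<longlonglongrightarrow> y"
      using e(2) rn(2) unfolding compact_def by simp
    then obtain y s where s: "strict_mono s" and y: "((\<lambda>n. f (X (r n))) \<circ> s) \<longlonglongrightarrow> y"
      by blast
    have "(X \<circ> (r \<circ> s)) \<longlonglongrightarrow> x"
      using X r s by (intro LIMSEQ_subseq_LIMSEQ strict_mono_o) auto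
    with y have "y = f x"
      using closed[OF x, of "X \<circ> (r \<circ> s)" y] X by (simp add: o_def)
    with y have "\<forall>\<^sub>F n in sequentially. dist (f (X (r (s n)))) (f x) < d"
      using d(1) by (auto simp: tendsto_iff o_def)
    with rn(1) show False by simp
  qed
qed

lemma polar_cocomplex_locally_bounded:
  assumes cos: "cosymplectic b \<psi>" and g: "g \<in> Riem"
  shows "\<exists>e>0. \<exists>K. compact K \<and> (\<forall>g'\<in>Riem. dist g' g < e \<longrightarrow> polar_cocomplex b \<psi> g' \<in> K)"
proof -
  obtain c D where cD: "c > 0" "D > 0"
    "\<And>v. c * (norm v)\<^sup>2 \<le> split_metric b \<psi> g v v" "\<And>v. split_metric b \<psi> g v v \<le> D * (norm v)\<^sup>2"
    by (rule inner_product_bounds[OF inner_product_split_metric[OF g]]) (rule that)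
  have "bounded_linear (proj1 b \<psi>)"
    using linear_proj1 linear_conv_bounded_linear by blast
  then obtain P where P: "P > 0" "\<And>v. norm (proj1 b \<psi> v) \<le> norm v * P"
    using bounded_linear.pos_bounded by blast
  \<comment> \<open>Within distance \<open>e\<close> of \<open>g\<close> the quadratic form of the
    split metric changes by at most \<open>c / 2 * (norm v)\<^sup>2\<close>. The bounds become
    \<open>c / 2\<close> and \<open>D + c / 2\<close>, and \<open>r\<close> is the square root of
    their ratio.\<close>
  define e where "e = c / (2 * P\<^sup>2)"
  define r where "r = sqrt ((2 * D + c) / c)"
  have "norm (polar_cocomplex b \<psi> g') \<le> r" if g': "g' \<in> Riem" "dist g' g < e" for g'
  proof -
    define J where "J = polar_cocomplex b \<psi> g'"
    have near: "\<bar>split_metric b \<psi> g' v v - split_metric b \<psi> g v v\<bar> \<le> c / 2 * (norm v)\<^sup>2" for v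
    proof -
      define x where "x = proj1 b \<psi> v"
      have "\<bar>(g' - g) x x\<bar> \<le> norm ((g' - g) x) * norm x"
        using norm_blinfun[of "(g' - g) x" x] by simp
      also have "\<dots> \<le> norm (g' - g) * norm x * norm x"
        by (intro mult_right_mono norm_blinfun) auto
      also have "\<dots> \<le> e * (norm v * P) * (norm v * P)"
        using g'(2) P by (intro mult_mono) (auto simp: x_def dist_norm e_def cD less_imp_le)
      also have "\<dots> = c / 2 * (norm v)\<^sup>2"
        using P(1) by (simp add: e_def power2_eq_square)
      finally show ?thesis
        by (simp add: split_metric_def blinfun.diff_left x_def)
    qed
    have "norm J \<le> r"
    proof (rule norm_blinfun_bound)
      fix v
      have "split_metric b \<psi> g' (J v) (J v) = split_metric b \<psi> g' v v"
        using polar_cocomplex_polar[OF cos g'(1)] by (simp add: polar_def J_def)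
      then have "c / 2 * (norm (J v))\<^sup>2 \<le> (D + c / 2) * (norm v)\<^sup>2"
        using near[of v, unfolded abs_le_iff] near[of "J v", unfolded abs_le_iff]
          cD(3)[of "J v"] cD(4)[of v] by (simp add: algebra_simps)
      then have "(norm (J v))\<^sup>2 \<le> (r * norm v)\<^sup>2"
        using cD(1,2) by (simp add: r_def power_mult_distrib field_simps)
      then show "norm (J v) \<le> r * norm v"
        by (rule power2_le_imp_le) (use cD in \<open>auto simp: r_def\<close>)
    qed (use cD in \<open>auto simp: r_def\<close>)
    then show ?thesis by (simp add: J_def)
  qed
  moreover have "e > 0" using cD(1) P(1) by (simp add: e_def)
  moreover have "compact (cball (0 :: 'a \<Rightarrow>\<^sub>L 'a) r)"
    by (simp add: compact_eq_bounded_closed)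
  ultimately show ?thesis
    by (intro exI[of _ e] conjI exI[of _ "cball 0 r"]) auto
qed

text \<open>Isometry, symmetry and semidefiniteness pass to limits;
  \<open>polarI_semidefinite\<close> recovers strict positivity, and uniqueness identifies the
  limit.\<close>

lemma continuous_on_polar_cocomplex:
  assumes cos: "cosymplectic b \<psi>"
  shows "continuous_on Riem (polar_cocomplex b \<psi>)"
proof (rule continuous_on_if_closed_graph_locally_compact)
  fix X g J
  assume g: "g \<in> Riem" and X: "\<And>n. X n \<in> Riem" "X \<longlonglongrightarrow> g"
    and J: "(\<lambda>n. polar_cocomplex b \<psi> (X n)) \<longlonglongrightarrow> J"
  define K where "K n = polar_cocomplex b \<psi> (X n)" for n
  have K: "split_metric b \<psi> (X n) (K n v) (K n v) = split_metric b \<psi> (X n) v v"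
    "inner_product (\<lambda>u v. flat b \<psi> u (K n v))" for n v
    using polar_cocomplex_polar[OF cos X(1)] by (auto simp: polar_def K_def)
  have lim: "K \<longlonglongrightarrow> J" using J by (simp add: K_def[abs_def])
  have "polar (split_metric b \<psi> g) (\<lambda>u. flat b \<psi> u) J"
  proof (rule polarI_semidefinite[OF inner_product_split_metric[OF g] bilinear_flat[of b \<psi>]
        flat_nondegenerate[OF cos]])
    have flat_lim: "(\<lambda>n. flat b \<psi> u (K n v)) \<longlonglongrightarrow> flat b \<psi> u (J v)" for u v
      by (intro tendsto_intros lim)
    show "flat b \<psi> u (J v) = flat b \<psi> v (J u)" for u v
    proof -
      have "flat b \<psi> u (K n v) = flat b \<psi> v (K n u)" for n
        by (rule inner_productD(2)[OF K(2)])
      then show ?thesis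
        using flat_lim[of u v] flat_lim[of v u] by (simp add: LIMSEQ_unique)
    qed
    show "flat b \<psi> v (J v) \<ge> 0" for v
    proof -
      have "flat b \<psi> v (K n v) \<ge> 0" for n
        by (rule inner_productD(4)[OF K(2)])
      then show ?thesis
        using flat_lim[of v v] by (auto intro: LIMSEQ_le_const)
    qed
    have "(\<lambda>n. split_metric b \<psi> (X n) (K n v) (K n v)) \<longlonglongrightarrow> split_metric b \<psi> g (J v) (J v)" for v
      unfolding split_metric_def proj1_def by (intro tendsto_intros lim X(2))
    moreover have "(\<lambda>n. split_metric b \<psi> (X n) v v) \<longlonglongrightarrow> split_metric b \<psi> g v v" for v
      unfolding split_metric_def proj1_def by (intro tendsto_intros X(2))
    ultimately show "split_metric b \<psi> g (J v) (J v) = split_metric b \<psi> g v v" for v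
      unfolding K(1) by (rule LIMSEQ_unique)
  qed
  then show "J = polar_cocomplex b \<psi> g"
    using polar_cocomplex_eqI[OF cos g] by simp
qed (rule polar_cocomplex_locally_bounded[OF cos])

theorem lemma2p21:
  shows "\<exists>F :: ('a::euclidean_space \<Rightarrow>\<^sub>L 'a \<Rightarrow>\<^sub>L real) \<Rightarrow> ('a \<Rightarrow>\<^sub>L real) \<Rightarrow>
      ('a \<Rightarrow>\<^sub>L 'a \<Rightarrow>\<^sub>L real) \<Rightarrow> ('a \<Rightarrow>\<^sub>L 'a).
    canonical F \<and>
    (\<forall>b \<psi>. cosymplectic b \<psi> \<longrightarrow>
      continuous_on Riem (F b \<psi>) \<and> F b \<psi> ` Riem = compatible_cocomplex b \<psi>)"
  using canonical_polar_cocomplex continuous_on_polar_cocomplex polar_cocomplex_in_compatible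
    compatible_cocomplex_in_range
  by (intro exI[of _ polar_cocomplex]) blast

end
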